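(* Let $K\subset\mathbb{R}$ be an interval with interior $K^0$, let $\varphi:K\to\mathbb{R}$ be continuous with $0\le\varphi\le\frac{\pi}{2}$, and let $a,b\in K^0$ with $a<a+e^{i\varphi}(b-a)$ and $[a,a+e^{i\varphi}(b-a)]\subset K$. Let $f:K\to(0,\infty)$ be twice differentiable on $K^0$ with $f''$ integrable on $[a,a+e^{i\varphi}(b-a)]$. Let $p\in\mathbb{R}$ with $p>1$. If $|f''|^{\frac{p}{p-1}}$ is a $\varphi$-convex function on $K^0$, then $$\left|\frac{1}{e^{i\varphi}(b-a)}\int_a^{a+e^{i\varphi}(b-a)}f(x)\,dx-\frac{f(a)+f(a+e^{i\varphi}(b-a))}{2}\right|\le\frac{e^{2i\varphi}(b-a)^2}{8}\left(\frac{\sqrt{\pi}}{2}\right)^{\frac1p}\left(\frac{\Gamma(p+1)}{\Gamma(\frac32+p)}\right)^{\frac1p}\left(\frac{|f''(a)|^{\frac{p}{p-1}}+|f''(b)|^{\frac{p}{p-1}}}{2}\right)^{\frac{p-1}{p}}.$$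
   Context: Here $i$ is the imaginary unit and $\Gamma$ is the Gamma function. In an expression $u+te^{i\varphi}(v-u)$ the argument of $\varphi$ is suppressed and $\varphi$ is read as its value at the base point $u$; thus $a+e^{i\varphi}(b-a)$ uses $\varphi=\varphi(a)$. Since $a+e^{i\varphi}(b-a)$ is an endpoint of a real interval, it is understood to be a real number. A set $S$ is $\varphi$-convex if $u+te^{i\varphi}(v-u)\in S$ for all $u,v\in S$ and $t\in[0,1]$. A real-valued function $g$ on a $\varphi$-convex set $S$ is $\varphi$-convex if $g(u+te^{i\varphi}(v-u))\le(1-t)g(u)+t\,g(v)$ for all $u,v\in S$, $t\in[0,1]$. Saying that $g$ is $\varphi$-convex on a set includes that the set is $\varphi$-convex. *)

theory Defs
  imports "HOL-Analysis.Analysis" "HOL-Library.Complex_Order"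
begin

(* The point u + t * e^(i phi(u)) * (v - u).  It is a complex number, even for real u and v;
   phi is evaluated at the base point u. *)
definition phi_point :: "(real \<Rightarrow> real) \<Rightarrow> real \<Rightarrow> real \<Rightarrow> real \<Rightarrow> complex" where
  "phi_point \<phi> u v t =
     complex_of_real u
       + complex_of_real t * exp (\<i> * complex_of_real (\<phi> u)) * complex_of_real (v - u)"

(* S is a set of reals, so membership of a phi_point in S includes that the point is real. *)
definition phi_convex_set :: "(real \<Rightarrow> real) \<Rightarrow> real set \<Rightarrow> bool" where
  "phi_convex_set \<phi> S \<longleftrightarrow>
     (\<forall>u\<in>S. \<forall>v\<in>S. \<forall>t\<in>{0..1}. phi_point \<phi> u v t \<in> complex_of_real ` S)"

(* On a phi_convex_set every phi_point is real, so Re only changes its type. *)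
definition phi_convex_on :: "(real \<Rightarrow> real) \<Rightarrow> real set \<Rightarrow> (real \<Rightarrow> real) \<Rightarrow> bool" where
  "phi_convex_on \<phi> S g \<longleftrightarrow>
     phi_convex_set \<phi> S \<and>
     (\<forall>u\<in>S. \<forall>v\<in>S. \<forall>t\<in>{0..1}. g (Re (phi_point \<phi> u v t)) \<le> (1 - t) * g u + t * g v)"

end

theory Submission
  imports Defs
begin

text \<open>
  Since \<open>c\<close> is real and \<open>b \<noteq> a\<close>, the sine of \<open>\<phi> a\<close> vanishes, so \<open>\<phi> a = 0\<close> and \<open>c = b\<close>:
  the inequality is a classical trapezoid estimate. After rescaling to the unit interval, two
  integrations by parts express the trapezoid error as \<open>- 1/2\<close> times the integral of
  \<open>t (1 - t) F''(t)\<close>. Hoelder's inequality bounds this by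
  \<open>Beta (p + 1) (p + 1)\<close> to the power \<open>1/p\<close>, which the duplication formula rewrites, times the
  mean of the endpoint values coming from convexity of the \<open>q\<close>-th power of \<open>F''\<close>.
\<close>

text \<open>Restriction of the complex duplication formula to the positive axis: there neither
  argument is a pole of Gamma, and every factor is an embedded real, so the embedding can be
  cancelled.\<close>

lemma Gamma_legendre_duplication_real:
  fixes x :: real
  assumes "0 < x"
  shows "Gamma x * Gamma (x + 1/2) = 2 powr (1 - 2 * x) * sqrt pi * Gamma (2 * x)"
proof -
  have nonpos: "complex_of_real y \<notin> \<int>\<^sub>\<le>\<^sub>0" if "0 < y" for y
    using that by (auto elim!: nonpos_Ints_cases simp: complex_eq_iff)
  have "complex_of_real x + 1/2 \<notin> \<int>\<^sub>\<le>\<^sub>0"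
    using nonpos[of "x + 1/2"] assms by simp
  from Gamma_legendre_duplication[OF nonpos[OF assms] this]
  have "complex_of_real (Gamma x * Gamma (x + 1/2)) =
        complex_of_real (exp ((1 - 2 * x) * ln 2) * sqrt pi * Gamma (2 * x))"
    by (simp flip: Gamma_complex_of_real exp_of_real)
  then show ?thesis
    by (simp only: of_real_eq_iff) (simp add: powr_def)
qed

text \<open>Duplication at \<open>p + 1\<close> eliminates \<open>Gamma (2 * p + 2)\<close> from the
  denominator of Beta. The power \<open>(1 / 4) powr p\<close> that appears becomes the constant 1/4
  under the p-th root.\<close>

lemma Beta_Suc_diagonal_powr:
  fixes p :: real
  assumes "0 < p"
  shows "Beta (p + 1) (p + 1) powr (1 / p) =
    1 / 4 * (sqrt pi / 2) powr (1 / p) * (Gamma (p + 1) / Gamma (3 / 2 + p)) powr (1 / p)"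
proof -
  let ?G = "Gamma (p + 1)" and ?H = "Gamma (3 / 2 + p)"
  have pos: "0 < ?G" "0 < ?H" "0 < Gamma (2 * p + 2)"
    using assms by auto
  have "2 powr (- 1 - 2 * p) = (1 / 4) powr p * (1 / 2 :: real)"
  proof -
    have "2 powr (- 1 - 2 * p) = 2 powr (- 2 * p) * 2 powr (- 1 :: real)"
      using powr_add[of 2 "- 2 * p" "- 1"] by (simp add: algebra_simps)
    also have "2 powr (- 2 * p) = (2 powr (- 2)) powr p"
      by (rule powr_powr [symmetric])
    finally show ?thesis
      by (simp add: powr_minus)
  qed
  moreover have "?G * ?H = 2 powr (- 1 - 2 * p) * sqrt pi * Gamma (2 * p + 2)"
    using Gamma_legendre_duplication_real[of "p + 1"] assms by (simp add: algebra_simps)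
  ultimately have "?G * ?H = (1 / 4) powr p * (sqrt pi / 2) * Gamma (2 * p + 2)"
    by simp
  then have "?G / Gamma (2 * p + 2) = (1 / 4) powr p * (sqrt pi / 2) / ?H"
    using pos by (simp add: field_simps)
  moreover have "Beta (p + 1) (p + 1) = ?G * (?G / Gamma (2 * p + 2))"
    by (simp add: Beta_def algebra_simps)
  ultimately have "Beta (p + 1) (p + 1) = (1 / 4) powr p * (sqrt pi / 2) * (?G / ?H)"
    by simp
  then have "Beta (p + 1) (p + 1) powr (1 / p) =
      ((1 / 4) powr p) powr (1 / p) * (sqrt pi / 2) powr (1 / p) * (?G / ?H) powr (1 / p)"
    using assms pos by (simp only: powr_mult)
  then show ?thesis
    using assms by (simp add: powr_powr)
qed

lemma trapezoid_error_unit_interval: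
  fixes F F' F'' :: "real \<Rightarrow> real"
  assumes F': "\<And>t. t \<in> {0..1} \<Longrightarrow> (F has_real_derivative F' t) (at t within {0..1})"
    and F'': "\<And>t. t \<in> {0..1} \<Longrightarrow> (F' has_real_derivative F'' t) (at t within {0..1})"
  shows "((\<lambda>t. t * (1 - t) * F'' t) has_integral F 0 + F 1 - 2 * integral {0..1} F) {0..1}"
proof -
  \<comment> \<open>Both integrations by parts in one antiderivative: in \<open>P'\<close> the terms
    with \<open>F'\<close> cancel and \<open>t * (1 - t) * F'' t + 2 * F t\<close> remains. The
    weight vanishes at 0 and 1, so \<open>P 1 - P 0\<close> is \<open>F 1 + F 0\<close>.\<close>
  define P where "P t = t * (1 - t) * F' t - (1 - 2 * t) * F t" for t
  have "(P has_vector_derivative t * (1 - t) * F'' t + 2 * F t) (at t within {0..1})"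
    if "t \<in> {0..1}" for t
    unfolding P_def has_real_derivative_iff_has_vector_derivative[symmetric]
    by (rule derivative_eq_intros F'[OF that] F''[OF that] refl)+ (simp add: algebra_simps)
  then have "((\<lambda>t. t * (1 - t) * F'' t + 2 * F t) has_integral P 1 - P 0) {0..1}"
    by (intro fundamental_theorem_of_calculus) auto
  moreover have "F integrable_on {0..1}"
    by (intro integrable_continuous_interval DERIV_continuous_on[of _ _ F'] F')
  then have "((\<lambda>t. 2 * F t) has_integral 2 * integral {0..1} F) {0..1}"
    by (intro has_integral_mult_right integrable_integral)
  ultimately have "((\<lambda>t. t * (1 - t) * F'' t + 2 * F t - 2 * F t) has_integral
      P 1 - P 0 - 2 * integral {0..1} F) {0..1}"
    by (rule has_integral_diff)
  then show ?thesis
    by (simp add: P_def add.commute)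
qed

text \<open>
  Hoelder's inequality is obtained by integrating Young's inequality, so that no integrability of
  the \<open>q\<close>-th power of \<open>g\<close> has to be known.
\<close>

lemma weighted_integral_bound_unit_interval:
  fixes g :: "real \<Rightarrow> real" and p q A B :: real
  assumes pq: "1 < p" "1 < q" "1 / p + 1 / q = 1" and AB: "0 \<le> A" "0 \<le> B"
    and int: "(\<lambda>t. t * (1 - t) * g t) integrable_on {0..1}"
    and bound: "\<And>t. t \<in> {0..1} \<Longrightarrow> \<bar>g t\<bar> powr q \<le> (1 - t) * A + t * B"
  shows "\<bar>integral {0..1} (\<lambda>t. t * (1 - t) * g t)\<bar>
    \<le> Beta (p + 1) (p + 1) powr (1 / p) * ((A + B) / 2) powr (1 / q)"
\<comment> \<open>The normalisation below divides by a power of \<open>(A + B) / 2\<close>. If this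
  mean is zero, the bound forces \<open>g\<close> to vanish on the interval.\<close>
proof (cases "A + B = 0")
  case True
  then have "A = 0" "B = 0"
    using AB by auto
  then have g0: "g t = 0" if "t \<in> {0..1}" for t
    using bound[OF that] by simp
  have "integral {0..1} (\<lambda>t. t * (1 - t) * g t) = integral {0..1} (\<lambda>t::real. 0)"
    by (intro Henstock_Kurzweil_Integration.integral_cong) (simp add: g0)
  then show ?thesis
    by simp
next
  case False
  define \<beta> where "\<beta> = Beta (p + 1) (p + 1)"
  define M where "M = (A + B) / 2"
  have pos: "0 < \<beta>" "0 < M"
    using False AB pq by (auto simp: \<beta>_def M_def Beta_def)
  let ?C = "\<beta> powr (1 / p) * M powr (1 / q)"
  \<comment> \<open>Pointwise majorant from Young's inequality. The two summands in the parentheses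
    integrate to \<open>1 / p\<close> and \<open>1 / q\<close>, so \<open>R\<close> integrates to
    exactly the desired bound \<open>?C\<close>.\<close>
  define R where "R t = ?C * (t powr p * (1 - t) powr p / (p * \<beta>) + ((1 - t) * A + t * B) / (q * M))"
    for t
  have "((\<lambda>t. t powr p * (1 - t) powr p) has_integral \<beta>) {0..1}"
    using has_integral_Beta_real[of "p + 1" "p + 1"] pq by (simp add: \<beta>_def)
  then have 1: "((\<lambda>t. t powr p * (1 - t) powr p / (p * \<beta>)) has_integral \<beta> / (p * \<beta>)) {0..1}"
    by (rule has_integral_divide)
  have "((\<lambda>t. (1 - t) * A + t * B) has_integral
      (\<lambda>t. t * A + t\<^sup>2 / 2 * (B - A)) 1 - (\<lambda>t. t * A + t\<^sup>2 / 2 * (B - A)) 0) {0..1}"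
    by (intro fundamental_theorem_of_calculus)
      (auto simp: field_simps simp flip: has_real_derivative_iff_has_vector_derivative
        intro!: derivative_eq_intros)
  then have "((\<lambda>t. (1 - t) * A + t * B) has_integral M) {0..1}"
    by (simp add: M_def field_simps)
  then have 2: "((\<lambda>t. ((1 - t) * A + t * B) / (q * M)) has_integral M / (q * M)) {0..1}"
    by (rule has_integral_divide)
  have sum: "\<beta> / (p * \<beta>) + M / (q * M) = 1"
    using pos pq by simp
  then have R: "(R has_integral ?C) {0..1}"
    using has_integral_mult_right[OF has_integral_add[OF 1 2], of ?C]
    unfolding sum by (simp add: R_def [abs_def])
  have "norm (t * (1 - t) * g t) \<le> R t" if t: "t \<in> {0..1}" for t
  proof -
    \<comment> \<open>Hoelder normalisation: \<open>x powr p\<close> has integral 1, and so does the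
      linear majorant of \<open>y powr q\<close>. The divisors multiply to
      \<open>?C\<close>.\<close>
    define x where "x = t * (1 - t) / \<beta> powr (1 / p)"
    define y where "y = \<bar>g t\<bar> / M powr (1 / q)"
    have nonneg: "0 \<le> x" "0 \<le> y"
      using t by (auto simp: x_def y_def)
    have "x powr p / p = t powr p * (1 - t) powr p / (p * \<beta>)"
      using t pos pq by (simp add: x_def powr_divide powr_mult powr_powr)
    moreover have "y powr q / q \<le> ((1 - t) * A + t * B) / (q * M)"
      using pos pq bound[OF t] by (simp add: y_def powr_divide powr_powr field_simps)
    ultimately have "x * y \<le> t powr p * (1 - t) powr p / (p * \<beta>) + ((1 - t) * A + t * B) / (q * M)"
      using Youngs_inequality[OF pq nonneg] by linarith
    then have "?C * (x * y) \<le> R t"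
      unfolding R_def using pos by (intro mult_left_mono) auto
    moreover have "norm (t * (1 - t) * g t) = ?C * (x * y)"
      using t pos by (simp add: x_def y_def abs_mult)
    ultimately show ?thesis
      by simp
  qed
  then have "norm (integral {0..1} (\<lambda>t. t * (1 - t) * g t)) \<le> integral {0..1} R"
    using R by (intro integral_norm_bound_integral int) auto
  then show ?thesis
    using integral_unique[OF R] by (simp add: \<beta>_def M_def)
qed

lemma trapezoid_bound:
  fixes f f' f'' :: "real \<Rightarrow> real" and a b p A B :: real
  assumes ab: "a < b" and p: "1 < p" and AB: "0 \<le> A" "0 \<le> B"
    and f': "\<And>x. x \<in> {a..b} \<Longrightarrow> (f has_real_derivative f' x) (at x within {a..b})"
    and f'': "\<And>x. x \<in> {a..b} \<Longrightarrow> (f' has_real_derivative f'' x) (at x within {a..b})"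
    and bound: "\<And>t. t \<in> {0..1} \<Longrightarrow>
      \<bar>f'' (a + t * (b - a))\<bar> powr (p / (p - 1)) \<le> (1 - t) * A + t * B"
  shows "\<bar>integral {a..b} f / (b - a) - (f a + f b) / 2\<bar>
    \<le> (b - a)\<^sup>2 / 8 * ((sqrt pi / 2) powr (1 / p) * (Gamma (p + 1) / Gamma (3 / 2 + p)) powr (1 / p)
      * ((A + B) / 2) powr ((p - 1) / p))"
proof -
  define h where "h = b - a"
  have h: "0 < h"
    using ab by (simp add: h_def)
  let ?x = "\<lambda>t. a + t * h"
  have x: "?x t \<in> {a..b}" if "t \<in> {0..1}" for t
    using mult_left_le_one_le[of h t] mult_nonneg_nonneg[of t h] that h h_def
    unfolding atLeastAtMost_iff by linarith
  have comp: "((\<lambda>t. u (?x t)) has_real_derivative u' (?x t) * h) (at t within {0..1})"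
    if u: "\<And>x. x \<in> {a..b} \<Longrightarrow> (u has_real_derivative u' x) (at x within {a..b})"
      and t: "t \<in> {0..1}" for u u' :: "real \<Rightarrow> real" and t
  proof -
    have "(?x has_real_derivative h) (at t within {0..1})"
      by (auto intro!: derivative_eq_intros)
    moreover have "(u has_real_derivative u' (?x t)) (at (?x t) within ?x ` {0..1})"
      using x by (intro DERIV_subset[OF u[OF x[OF t]]]) blast
    ultimately show ?thesis
      using DERIV_image_chain[of u _ ?x t "{0..1}" h] by (simp add: o_def)
  qed
  \<comment> \<open>Substituting \<open>a + t * h\<close> twice differentiated produces a factor
    \<open>h\<^sup>2\<close>; dividing by it beforehand makes the second derivative of
    \<open>F\<close> just \<open>f'' (a + t * h)\<close>.\<close>
  define F where "F t = f (?x t) / h\<^sup>2" for t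
  have F: "((\<lambda>t. t * (1 - t) * f'' (?x t)) has_integral F 0 + F 1 - 2 * integral {0..1} F) {0..1}"
  proof (rule trapezoid_error_unit_interval)
    fix t :: real assume t: "t \<in> {0..1}"
    show "(F has_real_derivative f' (?x t) / h) (at t within {0..1})"
      unfolding F_def using DERIV_cdivide[OF comp[OF f' t], of "h\<^sup>2"] h
      by (simp add: power2_eq_square)
    show "((\<lambda>t. f' (?x t) / h) has_real_derivative f'' (?x t)) (at t within {0..1})"
      using DERIV_cdivide[OF comp[OF f'' t], of h] h by simp
  qed
  have "f integrable_on {a..b}"
    by (intro integrable_continuous_interval DERIV_continuous_on[of _ _ f'] f')
  then have "(f has_integral integral {a..b} f) (cbox a b)"
    by (simp add: integrable_integral)
  \<comment> \<open>This is the right endpoint of the interval that the affine change of variables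
    produces; the left one is 0.\<close>
  moreover have "(b - a) /\<^sub>R h = 1"
    using h by (simp add: h_def)
  ultimately have "((\<lambda>t. f (?x t)) has_integral integral {a..b} f / h) {0..1}"
    using has_integral_affinity'[of f "integral {a..b} f" a b h a] h by (simp add: ac_simps divide_inverse)
  from has_integral_divide[OF this, of "h\<^sup>2"]
  have "integral {0..1} F = integral {a..b} f / h / h\<^sup>2"
    unfolding F_def by (rule integral_unique)
  moreover have "F 0 = f a / h\<^sup>2" "F 1 = f b / h\<^sup>2"
    by (simp_all add: F_def h_def)
  ultimately have err: "integral {a..b} f / h - (f a + f b) / 2 =
      - (h\<^sup>2 / 2) * integral {0..1} (\<lambda>t. t * (1 - t) * f'' (?x t))"
    using h unfolding integral_unique[OF F] by (simp add: field_simps)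
  have "\<bar>integral {0..1} (\<lambda>t. t * (1 - t) * f'' (?x t))\<bar>
    \<le> Beta (p + 1) (p + 1) powr (1 / p) * ((A + B) / 2) powr (1 / (p / (p - 1)))"
    using p bound F AB
    by (intro weighted_integral_bound_unit_interval) (auto simp: h_def field_simps)
  then have "h\<^sup>2 / 2 * \<bar>integral {0..1} (\<lambda>t. t * (1 - t) * f'' (?x t))\<bar>
    \<le> h\<^sup>2 / 2 * (Beta (p + 1) (p + 1) powr (1 / p) * ((A + B) / 2) powr ((p - 1) / p))"
    by (intro mult_left_mono) auto
  \<comment> \<open>The constant 1/8 is the 1/2 from the error formula times the 1/4 from the Beta
    value.\<close>
  then show ?thesis
    using p by (simp add: err[unfolded h_def] abs_mult h_def Beta_Suc_diagonal_powr)
qed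

theorem theorem7:
  fixes K :: "real set" and \<phi> f :: "real \<Rightarrow> real" and a b c p :: real
  assumes "is_interval K"
    and "continuous_on K \<phi>"
    and "\<forall>x\<in>K. 0 \<le> \<phi> x \<and> \<phi> x \<le> pi / 2"
    and "a \<in> interior K" and "b \<in> interior K"
    and "complex_of_real c =
           complex_of_real a + exp (\<i> * complex_of_real (\<phi> a)) * complex_of_real (b - a)"
    and "a < c" and "{a..c} \<subseteq> K"
    and "\<forall>x\<in>K. 0 < f x"
    and "\<forall>x\<in>interior K. f differentiable (at x) \<and> deriv f differentiable (at x)"
    and "deriv (deriv f) absolutely_integrable_on {a..c}"
    and "1 < p"
    and "phi_convex_on \<phi> (interior K) (\<lambda>x. \<bar>deriv (deriv f) x\<bar> powr (p / (p - 1)))"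
  shows "complex_of_real (cmod (
             1 / (exp (\<i> * complex_of_real (\<phi> a)) * complex_of_real (b - a))
               * complex_of_real (integral {a..c} f)
             - complex_of_real ((f a + f c) / 2)))
         \<le> exp (2 * \<i> * complex_of_real (\<phi> a)) * (complex_of_real (b - a))\<^sup>2 / 8
             * complex_of_real (
                 (sqrt pi / 2) powr (1 / p)
                 * (Gamma (p + 1) / Gamma (3 / 2 + p)) powr (1 / p)
                 * ((\<bar>deriv (deriv f) a\<bar> powr (p / (p - 1))
                     + \<bar>deriv (deriv f) b\<bar> powr (p / (p - 1))) / 2) powr ((p - 1) / p))"
proof -
  note c = assms(6) and deriv_K = assms(10) and conv = assms(13)
  have a_K: "a \<in> K"
    using assms(4) interior_subset by blast
  have "b \<noteq> a"
    using c \<open>a < c\<close> by auto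
  have "Im (complex_of_real c) = sin (\<phi> a) * (b - a)"
    unfolding c by (simp add: Im_exp)
  then have "sin (\<phi> a) = 0"
    using \<open>b \<noteq> a\<close> by simp
  \<comment> \<open>On \<open>[0, pi)\<close> the sine vanishes only at 0; the upper bound
    \<open>pi / 2\<close> on \<phi> is what excludes \<open>pi\<close>.\<close>
  moreover have "0 \<le> \<phi> a" "\<phi> a < pi"
    using bspec[OF assms(3) a_K] pi_half_gt_zero by linarith+
  ultimately have \<phi>: "\<phi> a = 0"
    using sin_gt_zero[of "\<phi> a"] by fastforce
  then have "complex_of_real c = complex_of_real b"
    using c by simp
  then have cb: "c = b"
    by (simp only: of_real_eq_iff)
  with \<open>a < c\<close> have ab: "a < b"
    by simp
  \<comment> \<open>Convexity places the whole closed segment in the interior, so two-sided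
    derivatives exist at its endpoints too.\<close>
  have "convex (interior K)"
    using assms(1) by (simp add: is_interval_convex_1)
  then have sub: "{a..b} \<subseteq> interior K"
    using assms(4,5) ab closed_segment_subset[of a "interior K" b]
    by (simp add: closed_segment_eq_real_ivl)
  let ?g = "\<lambda>x. \<bar>deriv (deriv f) x\<bar> powr (p / (p - 1))"
  have bound: "?g (a + t * (b - a)) \<le> (1 - t) * ?g a + t * ?g b" if "t \<in> {0..1}" for t
  proof -
    \<comment> \<open>With base point \<open>a\<close> and \<open>\<phi> a = 0\<close>, the
      \<phi>-point is the ordinary point \<open>a + t * (b - a)\<close>, so this becomes the usual
      convexity inequality between \<open>a\<close> and \<open>b\<close>.\<close>
    have "?g (Re (phi_point \<phi> a b t)) \<le> (1 - t) * ?g a + t * ?g b"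
      using conv that assms(4,5) unfolding phi_convex_on_def by blast
    then show ?thesis
      by (simp add: phi_point_def \<phi>)
  qed
  have main: "\<bar>integral {a..b} f / (b - a) - (f a + f b) / 2\<bar>
    \<le> (b - a)\<^sup>2 / 8 * ((sqrt pi / 2) powr (1 / p) * (Gamma (p + 1) / Gamma (3 / 2 + p)) powr (1 / p)
      * ((?g a + ?g b) / 2) powr ((p - 1) / p))"
  proof (rule trapezoid_bound[OF ab \<open>1 < p\<close> _ _ _ _ bound])
    fix x assume "x \<in> {a..b}"
    then have "f field_differentiable at x" "deriv f field_differentiable at x"
      using sub deriv_K
      by (auto simp: field_differentiable_def real_differentiable_def)
    then show "(f has_real_derivative deriv f x) (at x within {a..b})"
      "(deriv f has_real_derivative deriv (deriv f) x) (at x within {a..b})"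
      by (auto simp: DERIV_deriv_iff_field_differentiable intro: has_field_derivative_at_within)
  qed auto
  have "1 / (exp (\<i> * complex_of_real (\<phi> a)) * complex_of_real (b - a))
               * complex_of_real (integral {a..c} f) - complex_of_real ((f a + f c) / 2)
      = complex_of_real (integral {a..b} f / (b - a) - (f a + f b) / 2)"
    by (simp add: \<phi> cb)
  then have lhs: "cmod (1 / (exp (\<i> * complex_of_real (\<phi> a)) * complex_of_real (b - a))
               * complex_of_real (integral {a..c} f) - complex_of_real ((f a + f c) / 2))
      = \<bar>integral {a..b} f / (b - a) - (f a + f b) / 2\<bar>"
    by (simp only: norm_of_real)
  have rhs: "exp (2 * \<i> * complex_of_real (\<phi> a)) * (complex_of_real (b - a))\<^sup>2 / 8
      * complex_of_real r = complex_of_real ((b - a)\<^sup>2 / 8 * r)" for r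
    by (simp add: \<phi>)
  \<comment> \<open>The order on complex numbers asks for ordered real parts and equal imaginary
    parts; both sides are now embedded reals, so only \<open>main\<close> remains.\<close>
  show ?thesis
    unfolding lhs rhs using main by (simp only: less_eq_complex_def Re_complex_of_real Im_complex_of_real)
qed

end
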